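(* Let $F\hookrightarrow E\xrightarrow{\pi}X$ be a fiber bundle with closed oriented fibers over a smooth space $X$, and let $k>\dim F$. Let $h\in\widehat H^k(E;\mathbb Z)$ and let $\lambda$ be a transfer map, so that $\lambda(z)\in Z_{k-1}(E;\mathbb Z)$ satisfies $[\lambda(z)]_{\partial S_k}=[\mathrm{PB}_E\,\zeta(z)]_{\partial S_k}$ for all $z\in Z_{k-1-\dim F}(X;\mathbb Z)$. Then for any $z\in Z_{k-1-\dim F}(X;\mathbb Z)$ the fiber integral of $h$ is given by $$(\widehat\pi_!h)(z)=h(\lambda(z))\cdot\exp\Big(2\pi i\int_{a(z)}\fint_F\mathrm{curv}(h)\Big).$$
   Context: **Smooth spaces.** A differential space (Sikorski) is a topological space $X$ with a set $C^\infty(X)$ of continuous real functions such that $X$ carries the initial topology, $C^\infty(X)$ is local and closed under composition with smooth functions of several variables; forms $\Omega^*(X)$, integration over smooth singular chains and Stokes' theorem are available. A $p$-stratifold (Kreck, *Differential Algebraic Topology* ) is a differential space built inductively by attaching manifolds $W$ with collared boundary along proper smooth maps $\partial W\to S$ to lower-dimensional $p$-stratifolds $S$ (smooth functions being constant along collar lines near $\partial W$); oriented: top stratum oriented and codimension-one stratum empty; regular: locally at points of the $i$-th stratum a product of an open piece of the stratum with a stratifold having one-point $0$-stratum. A *smooth space* is a differential space for which: (i) smooth and continuous singular (co)homology agree; (ii) the de Rham theorem holds; (iii) pushing forward fundamental cycles gives an isomorphism from bordism of oriented $p$-stratifolds to integral smooth singular homology. **Differential characters.** $C_n\supset Z_n$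 denote smooth singular chains and cycles. For $k\ge1$, $\widehat H^k(X;\mathbb Z)$ is the abelian group of homomorphisms $h:Z_{k-1}(X;\mathbb Z)\to \mathrm U(1)$ for which there is a (unique) form $\mathrm{curv}(h)\in\Omega^k(X)$ with $h(\partial c)=\exp(2\pi i\int_c\mathrm{curv}(h))$ for all $c\in C_k(X;\mathbb Z)$. **Geometric cycles, pull-back, fiber integration.** $S_n(X;\mathbb Z)\subset C_n(X;\mathbb Z)$: thin chains $y$, i.e. $\int_y\omega=0$ for all $\omega\in\Omega^n(X)$. $[z]_{\partial S_{n+1}}$ is the class of $z$ in $Z_n(X;\mathbb Z)/\partial S_{n+1}(X;\mathbb Z)$. A degree-$(n+1)$ character $h$ is evaluated on such a class by evaluating it on any representative. A geometric $n$-cycle is a diffeomorphism class $[M\xrightarrow{g}X]$ of smooth maps, $M$ an oriented compact $n$-dimensional regular $p$-stratifold without boundary; it defines $[\,\cdot\,]_{\partial S_{n+1}}:=[g_*c]_{\partial S_{n+1}}$, $c$ any cycle representing the fundamental class of $M$. For each $z\in Z_n(X;\mathbb Z)$ choose a geometric cycle $\zeta(z)$ and a chain $a(z)\in C_{n+1}(X;\mathbb Z)$ with $[z-\partial a(z)]_{\partial S_{n+1}}=[\zeta(z)]_{\partial S_{n+1}}$. For $\zeta=[M\xrightarrow{g}X]$, $\mathrm{PB}_E(\zeta):=[g^*E\xrightarrow{G}E]$, with $G$ the induced bundle map and $g^*E$ oriented by "base first, then fiber". $\fint_F$ is fiber integration of forms, normalized by $\fint_F\pi^*\eta\wedge\omega=\eta\wedge\fint_F\omega$.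 For $k>\dim F$, fiber integration $\widehat\pi_!:\widehat H^k(E;\mathbb Z)\to\widehat H^{k-\dim F}(X;\mathbb Z)$ is defined by $(\widehat\pi_!h)(z):=h([\mathrm{PB}_E\zeta(z)]_{\partial S_k})\cdot\exp(2\pi i\int_{a(z)}\fint_F\mathrm{curv}(h))$. *)

theory Defs
  imports "HOL-Analysis.Analysis" "HOL-Homology.Homology" "Jordan_Normal_Form.Determinant"
begin

section \<open>Differential spaces\<close>

text \<open>
  A differential space is a carrier with its set of smooth functions; its topology is
  the initial one, so it is not a separate datum. Smooth functions are total functions
  of which only the values on the carrier matter: the locality axiom below forces the
  set of smooth functions to be closed under changes off the carrier.
\<close>

record 'a dspace =
  points :: "'a set"
  smooth :: "('a \<Rightarrow> real) set"

definition init_top :: "'a set \<Rightarrow> ('a \<Rightarrow> real) set \<Rightarrow> 'a topology" where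
  "init_top A G = topology_generated_by (insert A {{x \<in> A. f x \<in> U} | f U. f \<in> G \<and> open U})"

abbreviation dtop :: "'a dspace \<Rightarrow> 'a topology" where
  "dtop X \<equiv> init_top (points X) (smooth X)"

text \<open>
  Smooth functions on \<open>\<real>\<^sup>n\<close> (carrier \<^term>\<open>topspace (Euclidean_space n)\<close>): \<open>D is\<close> is the
  iterated partial derivative along the multi-index \<open>is\<close>; all of them exist and are continuous.
\<close>

definition smooth_Rn :: "nat \<Rightarrow> ((nat \<Rightarrow> real) \<Rightarrow> real) set" where
  "smooth_Rn n = {f. \<exists>D. (\<forall>x \<in> topspace (Euclidean_space n). D [] x = f x) \<and>
     (\<forall>is. set is \<subseteq> {..<n} \<longrightarrow>
        continuous_map (Euclidean_space n) euclideanreal (D is) \<and>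
        (\<forall>i<n. \<forall>x \<in> topspace (Euclidean_space n).
           ((\<lambda>t. D is (x(i := t))) has_real_derivative D (i # is) x) (at (x i))))}"

definition Rn :: "nat \<Rightarrow> (nat \<Rightarrow> real) dspace" where
  "Rn n = \<lparr>points = topspace (Euclidean_space n), smooth = smooth_Rn n\<rparr>"

definition comp_fun ::
  "nat \<Rightarrow> ((nat \<Rightarrow> real) \<Rightarrow> real) \<Rightarrow> (nat \<Rightarrow> 'a \<Rightarrow> real) \<Rightarrow> 'a \<Rightarrow> real" where
  "comp_fun n F fs = (\<lambda>x. F (\<lambda>i. if i < n then fs i x else 0))"

definition diff_space :: "'a dspace \<Rightarrow> bool" where
  "diff_space X \<longleftrightarrow>
     (\<forall>f. (\<forall>x \<in> points X. \<exists>U g. openin (dtop X) U \<and> x \<in> U \<and> g \<in> smooth X \<and> (\<forall>y \<in> U. f y = g y))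
          \<longrightarrow> f \<in> smooth X) \<and>
     (\<forall>n F fs. F \<in> smooth_Rn n \<and> (\<forall>i<n. fs i \<in> smooth X) \<longrightarrow> comp_fun n F fs \<in> smooth X)"

definition generated :: "'a set \<Rightarrow> ('a \<Rightarrow> real) set \<Rightarrow> 'a dspace" where
  "generated A G = \<lparr>points = A, smooth = {f. \<forall>x \<in> A. \<exists>U n F fs. openin (init_top A G) U \<and> x \<in> U \<and>
     F \<in> smooth_Rn n \<and> (\<forall>i<n. fs i \<in> G) \<and> (\<forall>y \<in> U. f y = comp_fun n F fs y)}\<rparr>"

definition dsubspace :: "'a dspace \<Rightarrow> 'a set \<Rightarrow> 'a dspace" where
  "dsubspace X A = generated (A \<inter> points X) (smooth X)"

definition dprod :: "'a dspace \<Rightarrow> 'b dspace \<Rightarrow> ('a \<times> 'b) dspace" where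
  "dprod X Y = generated (points X \<times> points Y) ((\<lambda>f. f \<circ> fst) ` smooth X \<union> (\<lambda>g. g \<circ> snd) ` smooth Y)"

definition smooth_map :: "'a dspace \<Rightarrow> 'b dspace \<Rightarrow> ('a \<Rightarrow> 'b) \<Rightarrow> bool" where
  "smooth_map X Y f \<longleftrightarrow> f \<in> points X \<rightarrow> points Y \<and> (\<forall>g \<in> smooth Y. g \<circ> f \<in> smooth X)"

definition diffeo :: "'a dspace \<Rightarrow> 'b dspace \<Rightarrow> ('a \<Rightarrow> 'b) \<Rightarrow> bool" where
  "diffeo X Y f \<longleftrightarrow> smooth_map X Y f \<and>
     (\<exists>g. smooth_map Y X g \<and> (\<forall>x \<in> points X. g (f x) = x) \<and> (\<forall>y \<in> points Y. f (g y) = y))"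

section \<open>Tangent vectors, strata and orientations\<close>

text \<open>Tangent vectors are derivations, set to 0 on functions that are not smooth.\<close>

type_synonym 'a tvec = "('a \<Rightarrow> real) \<Rightarrow> real"

definition tangent :: "'a dspace \<Rightarrow> 'a \<Rightarrow> 'a tvec set" where
  "tangent X x = {v. (\<forall>f. f \<notin> smooth X \<longrightarrow> v f = 0) \<and>
     (\<forall>f \<in> smooth X. \<forall>g \<in> smooth X. v (\<lambda>y. f y + g y) = v f + v g) \<and>
     (\<forall>f \<in> smooth X. \<forall>r. v (\<lambda>y. r * f y) = r * v f) \<and>
     (\<forall>f \<in> smooth X. \<forall>g \<in> smooth X. v (\<lambda>y. f y * g y) = f x * v g + g x * v f)}"

definition pushfwd :: "'b dspace \<Rightarrow> ('a \<Rightarrow> 'b) \<Rightarrow> 'a tvec \<Rightarrow> 'b tvec" where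
  "pushfwd Y \<phi> v = (\<lambda>g. if g \<in> smooth Y then v (g \<circ> \<phi>) else 0)"

definition tangent_basis :: "'a dspace \<Rightarrow> 'a \<Rightarrow> 'a tvec list \<Rightarrow> bool" where
  "tangent_basis X x vs \<longleftrightarrow> set vs \<subseteq> tangent X x \<and>
     (\<forall>v \<in> tangent X x. \<exists>!a. a \<in> extensional {..<length vs} \<and>
        v = (\<lambda>f. \<Sum>i<length vs. a i * (vs ! i) f))"

definition same_orientation :: "'a tvec list \<Rightarrow> 'a tvec list \<Rightarrow> bool" where
  "same_orientation us vs \<longleftrightarrow> length us = length vs \<and>
     (\<exists>A \<in> carrier_mat (length vs) (length vs).
        (\<forall>i<length us. us ! i = (\<lambda>f. \<Sum>j<length vs. A $$ (i, j) * (vs ! j) f)) \<and>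
        Determinant.det A > 0)"

text \<open>As for stratifolds, the strata are determined by the dimensions of the tangent spaces.\<close>

definition stratum :: "nat \<Rightarrow> 'a dspace \<Rightarrow> 'a set" where
  "stratum i X = {x \<in> points X. \<exists>vs. length vs = i \<and> tangent_basis X x vs}"

text \<open>A local parametrization with domain \<open>V \<subseteq> \<real>\<^sup>n\<close>, and its coordinate frame at \<open>v\<close>.\<close>

definition local_param :: "nat \<Rightarrow> 'a dspace \<Rightarrow> (nat \<Rightarrow> real) set \<Rightarrow> ((nat \<Rightarrow> real) \<Rightarrow> 'a) \<Rightarrow> bool" where
  "local_param n X V \<psi> \<longleftrightarrow> openin (Euclidean_space n) V \<and> openin (dtop X) (\<psi> ` V) \<and>
     diffeo (dsubspace (Rn n) V) (dsubspace X (\<psi> ` V)) \<psi>"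

definition coord_frame ::
  "nat \<Rightarrow> 'a dspace \<Rightarrow> ((nat \<Rightarrow> real) \<Rightarrow> 'a) \<Rightarrow> (nat \<Rightarrow> real) \<Rightarrow> 'a tvec list" where
  "coord_frame n X \<psi> v =
     map (\<lambda>i f. if f \<in> smooth X then deriv (\<lambda>t. f (\<psi> (v(i := t)))) (v i) else 0) [0..<n]"

definition manifold :: "nat \<Rightarrow> 'a dspace \<Rightarrow> bool" where
  "manifold n X \<longleftrightarrow> diff_space X \<and> Hausdorff_space (dtop X) \<and> second_countable (dtop X) \<and>
     (\<forall>x \<in> points X. \<exists>V \<psi>. local_param n X V \<psi> \<and> x \<in> \<psi> ` V)"

text \<open>
  An orientation of the \<open>n\<close>-dimensional stratum is given by its positive frames. For \<open>n = 0\<close>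
  the only frame is \<^term>\<open>[]\<close>, and a point is positive iff this frame is.
\<close>

type_synonym 'a orient = "'a \<Rightarrow> 'a tvec list set"

definition orientation :: "nat \<Rightarrow> 'a dspace \<Rightarrow> 'a orient \<Rightarrow> bool" where
  "orientation n X ori \<longleftrightarrow>
     (\<forall>x. ori x \<subseteq> {us. x \<in> stratum n X \<and> length us = n \<and> tangent_basis X x us}) \<and>
     (\<forall>x \<in> stratum n X. \<forall>us vs. length us = n \<and> tangent_basis X x us \<and> length vs = n \<and> tangent_basis X x vs \<longrightarrow>
        (same_orientation us vs \<longleftrightarrow> (us \<in> ori x \<longleftrightarrow> vs \<in> ori x))) \<and>
     (\<forall>x \<in> stratum n X. \<exists>V \<psi>. local_param n X V \<psi> \<and> x \<in> \<psi> ` V \<and>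
        ((\<forall>v \<in> V. coord_frame n X \<psi> v \<in> ori (\<psi> v)) \<or> (\<forall>v \<in> V. coord_frame n X \<psi> v \<notin> ori (\<psi> v))))"

section \<open>Stratifolds\<close>

text \<open>
  \<open>c\<close> is a collar of the closed subset \<open>B\<close> of \<open>W\<close>; the half-open interval is the
  differential space generated by its coordinate function.
\<close>

definition collar :: "'a dspace \<Rightarrow> 'a set \<Rightarrow> ('a \<times> real \<Rightarrow> 'a) \<Rightarrow> bool" where
  "collar W B c \<longleftrightarrow> closedin (dtop W) B \<and>
     (\<exists>V. openin (dtop W) V \<and>
        diffeo (dprod (dsubspace W B) (generated {0..<1} {\<lambda>t. t})) (dsubspace W V) c) \<and>
     (\<forall>x \<in> B. c (x, 0) = x)"

definition collared_manifold :: "nat \<Rightarrow> 'a dspace \<Rightarrow> 'a set \<Rightarrow> ('a \<times> real \<Rightarrow> 'a) \<Rightarrow> bool" where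
  "collared_manifold m W B c \<longleftrightarrow> m > 0 \<and> diff_space W \<and>
     Hausdorff_space (dtop W) \<and> second_countable (dtop W) \<and> collar W B c \<and>
     manifold m (dsubspace W (points W - B)) \<and> manifold (m - 1) (dsubspace W B)"

text \<open>
  \<open>X\<close> is \<open>S\<close> with \<open>W\<close> attached along \<open>f : B \<rightarrow> S\<close>, where \<open>q : W \<rightarrow> X\<close> is the quotient map.
\<close>

definition attached ::
  "'a dspace \<Rightarrow> 'a dspace \<Rightarrow> 'w dspace \<Rightarrow> 'w set \<Rightarrow> ('w \<times> real \<Rightarrow> 'w) \<Rightarrow> ('w \<Rightarrow> 'a) \<Rightarrow> ('w \<Rightarrow> 'a) \<Rightarrow> bool" where
  "attached X S W B c f q \<longleftrightarrow>
     smooth_map (dsubspace W B) S f \<and> proper_map (dtop (dsubspace W B)) (dtop S) f \<and>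
     points S \<subseteq> points X \<and> (\<forall>x \<in> B. q x = f x) \<and>
     bij_betw q (points W - B) (points X - points S) \<and>
     smooth X = {g. g \<in> smooth S \<and> g \<circ> q \<in> smooth (dsubspace W (points W - B)) \<and>
       (\<forall>x \<in> B. \<exists>V \<delta>. openin (dtop (dsubspace W B)) V \<and> x \<in> V \<and> 0 < \<delta> \<and>
          (\<forall>y \<in> V. \<forall>t. 0 \<le> t \<and> t < \<delta> \<and> t < 1 \<longrightarrow> g (q (c (y, t))) = g (f y)))}"

text \<open>
  \<^term>\<open>pstratifold n X\<close> says that \<open>X\<close> is a p-stratifold of dimension at most \<open>n\<close>: the top
  stratum may be empty, in particular the empty space is a p-stratifold of every dimension.
  Second countable manifolds have at most the cardinality of the continuum, so taking the
  carriers of the attached manifolds to be sets of reals is no restriction.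
\<close>

inductive pstratifold :: "nat \<Rightarrow> 'a dspace \<Rightarrow> bool" where
  base: "manifold 0 X \<Longrightarrow> pstratifold 0 X"
| attach: "pstratifold k S \<Longrightarrow> k < m \<Longrightarrow> collared_manifold m (W :: real dspace) B c \<Longrightarrow>
    attached X S W B c f q \<Longrightarrow> pstratifold m X"

text \<open>Kreck's (not necessarily parametrized) stratifolds.\<close>

definition stratifold :: "nat \<Rightarrow> 'a dspace \<Rightarrow> bool" where
  "stratifold n X \<longleftrightarrow> diff_space X \<and> locally_compact_space (dtop X) \<and> Hausdorff_space (dtop X) \<and>
     second_countable (dtop X) \<and> points X = (\<Union>i\<le>n. stratum i X) \<and>
     (\<forall>i. closedin (dtop X) (\<Union>j\<le>i. stratum j X) \<and> manifold i (dsubspace X (stratum i X))) \<and>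
     (\<forall>i. \<forall>x \<in> stratum i X. \<forall>f \<in> smooth X. \<forall>U. openin (dtop X) U \<and> x \<in> U \<and> (\<forall>y \<in> U \<inter> stratum i X. f y = 0) \<longrightarrow>
        (\<exists>V. openin (dtop X) V \<and> x \<in> V \<and> (\<forall>y \<in> V. f y = 0))) \<and>
     (\<forall>U. \<forall>x \<in> U. openin (dtop X) U \<longrightarrow>
        (\<exists>\<rho> \<in> smooth X. (\<forall>y \<in> points X. 0 \<le> \<rho> y) \<and> \<rho> x \<noteq> 0 \<and>
           dtop X closure_of {y \<in> points X. \<rho> y \<noteq> 0} \<subseteq> U))"

definition regular :: "'a dspace \<Rightarrow> bool" where
  "regular X \<longleftrightarrow> (\<forall>i. \<forall>x \<in> stratum i X. \<exists>U B m (F :: real dspace) pt \<phi>.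
     openin (dtop X) U \<and> x \<in> B \<and> B \<subseteq> U \<and> openin (subtopology (dtop X) (stratum i X)) B \<and>
     stratifold m F \<and> stratum 0 F = {pt} \<and>
     diffeo (dprod (dsubspace X B) F) (dsubspace X U) \<phi> \<and> (\<forall>y \<in> B. \<phi> (y, pt) = y))"

definition oriented_pstratifold :: "nat \<Rightarrow> 'a dspace \<Rightarrow> 'a orient \<Rightarrow> bool" where
  "oriented_pstratifold n X ori \<longleftrightarrow> pstratifold n X \<and> (n > 0 \<longrightarrow> stratum (n - 1) X = {}) \<and> orientation n X ori"

section \<open>Smooth singular chains, forms and integration\<close>

definition smooth_simplex :: "nat \<Rightarrow> 'a dspace \<Rightarrow> ((nat \<Rightarrow> real) \<Rightarrow> 'a) \<Rightarrow> bool" where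
  "smooth_simplex p X \<sigma> \<longleftrightarrow> singular_simplex p (dtop X) \<sigma> \<and>
     smooth_map (dsubspace (Rn (Suc p)) (standard_simplex p)) X \<sigma>"

definition smooth_chains :: "nat \<Rightarrow> 'a dspace \<Rightarrow> 'a chain set" where
  "smooth_chains p X = {c. Poly_Mapping.keys c \<subseteq> Collect (smooth_simplex p X)}"

definition smooth_cycles :: "nat \<Rightarrow> 'a dspace \<Rightarrow> 'a chain set" where
  "smooth_cycles p X = {c \<in> smooth_chains p X. chain_boundary p c = 0}"

definition open_simplex :: "nat \<Rightarrow> (nat \<Rightarrow> real) set" where
  "open_simplex p = {t \<in> standard_simplex p. \<forall>i\<le>p. 0 < t i}"

text \<open>
  The image under \<open>d\<sigma>\<close>, at an interior point \<open>t\<close>, of the edge vectors \<open>e\<^sub>i - e\<^sub>0\<close>, \<open>i = 1, \<dots>, p\<close>,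
  where \<open>e\<^sub>0, \<dots>, e\<^sub>p\<close> are the vertices of the standard simplex.
\<close>

definition simplex_frame ::
  "nat \<Rightarrow> 'a dspace \<Rightarrow> ((nat \<Rightarrow> real) \<Rightarrow> 'a) \<Rightarrow> (nat \<Rightarrow> real) \<Rightarrow> 'a tvec list" where
  "simplex_frame p X \<sigma> t =
     map (\<lambda>i f. if f \<in> smooth X then deriv (\<lambda>s. f (\<sigma> (t(0 := t 0 - s, i := t i + s)))) 0 else 0) [1..<Suc p]"

definition frames :: "nat \<Rightarrow> 'a dspace \<Rightarrow> 'a \<Rightarrow> 'a tvec list set" where
  "frames k X x = {simplex_frame k X \<sigma> t | \<sigma> t. smooth_simplex k X \<sigma> \<and> t \<in> open_simplex k \<and> \<sigma> t = x}"

text \<open>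
  A \<open>k\<close>-form is locally a finite sum \<open>\<Sum>\<^sub>j f\<^sub>j\<^sub>0 df\<^sub>j\<^sub>1 \<and> \<dots> \<and> df\<^sub>j\<^sub>k\<close>. It is only evaluated on those
  \<open>k\<close>-tuples of tangent vectors that are realized simultaneously by a smooth \<open>k\<close>-simplex (and
  set to 0 on other arguments). Thus forms whose pull-backs along all smooth simplices agree
  are equal, which makes the curvature of a differential character unique.
\<close>

type_synonym 'a form = "'a \<Rightarrow> 'a tvec list \<Rightarrow> real"

definition wedge_d :: "nat \<Rightarrow> (nat \<Rightarrow> 'a \<Rightarrow> real) \<Rightarrow> 'a tvec list \<Rightarrow> real" where
  "wedge_d k f vs = Determinant.det (Matrix.mat k k (\<lambda>(p, q). (vs ! p) (f q)))"

definition local_rep ::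
  "nat \<Rightarrow> 'a dspace \<Rightarrow> 'a form \<Rightarrow> 'a set \<Rightarrow> nat \<Rightarrow> (nat \<Rightarrow> nat \<Rightarrow> 'a \<Rightarrow> real) \<Rightarrow> bool" where
  "local_rep k X \<omega> U m f \<longleftrightarrow> openin (dtop X) U \<and> (\<forall>j<m. \<forall>i\<le>k. f j i \<in> smooth X) \<and>
     (\<forall>y \<in> U. \<forall>vs \<in> frames k X y. \<omega> y vs = (\<Sum>j<m. f j 0 y * wedge_d k (\<lambda>q. f j (Suc q)) vs))"

definition forms :: "nat \<Rightarrow> 'a dspace \<Rightarrow> 'a form set" where
  "forms k X = {\<omega>. (\<forall>x vs. vs \<notin> frames k X x \<longrightarrow> \<omega> x vs = 0) \<and>
     (\<forall>x \<in> points X. \<exists>U m f. x \<in> U \<and> local_rep k X \<omega> U m f)}"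

text \<open>\<^term>\<open>ext_deriv k X \<omega> \<eta>\<close> says that \<open>d\<omega> = \<eta>\<close>.\<close>

definition ext_deriv :: "nat \<Rightarrow> 'a dspace \<Rightarrow> 'a form \<Rightarrow> 'a form \<Rightarrow> bool" where
  "ext_deriv k X \<omega> \<eta> \<longleftrightarrow> \<omega> \<in> forms k X \<and> \<eta> \<in> forms (Suc k) X \<and>
     (\<forall>x \<in> points X. \<exists>U m f. x \<in> U \<and> local_rep k X \<omega> U m f \<and>
        (\<forall>y \<in> U. \<forall>vs \<in> frames (Suc k) X y. \<eta> y vs = (\<Sum>j<m. wedge_d (Suc k) (f j) vs)))"

definition closed_form :: "nat \<Rightarrow> 'a dspace \<Rightarrow> 'a form \<Rightarrow> bool" where
  "closed_form k X \<omega> \<longleftrightarrow> ext_deriv k X \<omega> (\<lambda>_ _. 0)"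

definition exact_form :: "nat \<Rightarrow> 'a dspace \<Rightarrow> 'a form \<Rightarrow> bool" where
  "exact_form k X \<omega> \<longleftrightarrow> (case k of 0 \<Rightarrow> \<omega> = (\<lambda>_ _. 0) | Suc l \<Rightarrow> (\<exists>\<eta>. ext_deriv l X \<eta> \<omega>))"

text \<open>
  The standard \<open>p\<close>-simplex is parametrized by \<open>(s\<^sub>1, \<dots>, s\<^sub>p) \<mapsto> (1 - \<Sum>\<^sub>i s\<^sub>i, s\<^sub>1, \<dots>, s\<^sub>p)\<close>; its
  boundary is a null set.
\<close>

definition simplex_point :: "nat \<Rightarrow> (nat \<Rightarrow> real) \<Rightarrow> nat \<Rightarrow> real" where
  "simplex_point p s = (\<lambda>i. if i = 0 then 1 - (\<Sum>j\<in>{1..p}. s j) else if i \<le> p then s i else 0)"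

definition simplex_integral :: "nat \<Rightarrow> 'a dspace \<Rightarrow> ((nat \<Rightarrow> real) \<Rightarrow> 'a) \<Rightarrow> 'a form \<Rightarrow> real" where
  "simplex_integral p X \<sigma> \<omega> =
     (LINT s | Pi\<^sub>M {1..p} (\<lambda>_. lborel).
        indicator (open_simplex p) (simplex_point p s) *
        \<omega> (\<sigma> (simplex_point p s)) (simplex_frame p X \<sigma> (simplex_point p s)))"

definition chain_integral :: "nat \<Rightarrow> 'a dspace \<Rightarrow> 'a chain \<Rightarrow> 'a form \<Rightarrow> real" where
  "chain_integral p X c \<omega> =
     (\<Sum>\<sigma> \<in> Poly_Mapping.keys c. of_int (Poly_Mapping.lookup c \<sigma>) * simplex_integral p X \<sigma> \<omega>)"

text \<open>
  Cochains on a complex of groups of singular chains. In degree 0 a cochain \<open>w\<close> of degree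
  \<open>p - 1\<close> contributes nothing, as the library sets \<^term>\<open>chain_boundary 0 c = 0\<close>.
\<close>

definition cochain :: "(nat \<Rightarrow> 'a chain set) \<Rightarrow> nat \<Rightarrow> ('a chain \<Rightarrow> 'g::ab_group_add) \<Rightarrow> bool" where
  "cochain C p u \<longleftrightarrow> (\<forall>c \<in> C p. \<forall>c' \<in> C p. u (c + c') = u c + u c')"

definition cocycle :: "(nat \<Rightarrow> 'a chain set) \<Rightarrow> nat \<Rightarrow> ('a chain \<Rightarrow> 'g::ab_group_add) \<Rightarrow> bool" where
  "cocycle C p u \<longleftrightarrow> cochain C p u \<and> (\<forall>c \<in> C (Suc p). u (chain_boundary (Suc p) c) = 0)"

definition coboundary :: "(nat \<Rightarrow> 'a chain set) \<Rightarrow> nat \<Rightarrow> ('a chain \<Rightarrow> 'g::ab_group_add) \<Rightarrow> bool" where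
  "coboundary C p u \<longleftrightarrow> (\<exists>w. cochain C (p - 1) w \<and> (\<forall>c \<in> C p. u c = w (chain_boundary p c)))"

section \<open>Geometric cycles\<close>

text \<open>
  A smooth cycle represents the fundamental class iff at each point of the top stratum it
  restricts to the local orientation class, i.e. to the class of a smoothly embedded simplex
  around that point, with the sign given by the orientation.
\<close>

definition fundamental_cycle :: "nat \<Rightarrow> 'a dspace \<Rightarrow> 'a orient \<Rightarrow> 'a chain \<Rightarrow> bool" where
  "fundamental_cycle n M ori c \<longleftrightarrow> c \<in> smooth_cycles n M \<and>
     (\<forall>x \<in> stratum n M. \<exists>\<sigma> t. smooth_simplex n M \<sigma> \<and> \<sigma> ` standard_simplex n \<subseteq> stratum n M \<and>
        diffeo (dsubspace (Rn (Suc n)) (standard_simplex n)) (dsubspace M (\<sigma> ` standard_simplex n)) \<sigma> \<and>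
        t \<in> open_simplex n \<and> \<sigma> t = x \<and>
        homologous_rel n (dtop M) (points M - {x}) c
          (if simplex_frame n M \<sigma> t \<in> ori x then frag_of \<sigma> else - frag_of \<sigma>))"

type_synonym ('m, 'a) cycle_rep = "'m dspace \<times> 'm orient \<times> ('m \<Rightarrow> 'a)"

definition cycle_rep :: "nat \<Rightarrow> 'a dspace \<Rightarrow> ('m, 'a) cycle_rep \<Rightarrow> bool" where
  "cycle_rep n X = (\<lambda>(M, ori, g). oriented_pstratifold n M ori \<and> regular M \<and>
     compact_space (dtop M) \<and> smooth_map M X g)"

definition iso_rep :: "('m, 'a) cycle_rep \<Rightarrow> ('n, 'a) cycle_rep \<Rightarrow> bool" where
  "iso_rep = (\<lambda>(M, ori, g) (M', ori', g'). \<exists>\<phi>. diffeo M M' \<phi> \<and>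
     (\<forall>x \<in> points M. g x = g' (\<phi> x) \<and>
        (\<forall>us. tangent_basis M x us \<longrightarrow> (us \<in> ori x \<longleftrightarrow> map (pushfwd M' \<phi>) us \<in> ori' (\<phi> x)))))"

text \<open>
  A geometric cycle is a diffeomorphism class. As p-stratifolds have at most the cardinality
  of the continuum, sets of reals suffice as carriers of its representatives.
\<close>

type_synonym 'a geom_cycle = "(real, 'a) cycle_rep set"

definition geom_cycles :: "nat \<Rightarrow> 'a dspace \<Rightarrow> 'a geom_cycle set" where
  "geom_cycles n X = {{r'. cycle_rep n X r' \<and> iso_rep r' r} | r :: (real, 'a) cycle_rep. cycle_rep n X r}"

definition thin_chains :: "nat \<Rightarrow> 'a dspace \<Rightarrow> 'a chain set" where
  "thin_chains n X = {y \<in> smooth_chains n X. \<forall>\<omega> \<in> forms n X. chain_integral n X y \<omega> = 0}"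

text \<open>The classes \<open>[z]\<close> and \<open>[\<zeta>]\<close> in \<open>Z\<^sub>n(X;\<int>) / \<partial>S\<^sub>n\<^sub>+\<^sub>1(X;\<int>)\<close>.\<close>

definition thin_class :: "nat \<Rightarrow> 'a dspace \<Rightarrow> 'a chain \<Rightarrow> 'a chain set" where
  "thin_class n X z = {z + chain_boundary (Suc n) y | y. y \<in> thin_chains (Suc n) X}"

definition geom_class :: "nat \<Rightarrow> 'a dspace \<Rightarrow> 'a geom_cycle \<Rightarrow> 'a chain set" where
  "geom_class n X \<zeta> =
     (\<Union>(M, ori, g) \<in> \<zeta>. \<Union>c \<in> Collect (fundamental_cycle n M ori). thin_class n X (chain_map n g c))"

section \<open>Smooth spaces\<close>

text \<open>
  A compact regular oriented \<open>(n+1)\<close>-dimensional p-stratifold \<open>T\<close> with collared boundary \<open>B\<close>;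
  the orientation \<open>ori\<close> is one of the complement of the boundary.
\<close>

definition bordism :: "nat \<Rightarrow> 'a dspace \<Rightarrow> 'a set \<Rightarrow> ('a \<times> real \<Rightarrow> 'a) \<Rightarrow> 'a orient \<Rightarrow> bool" where
  "bordism n T B c ori \<longleftrightarrow> diff_space T \<and> Hausdorff_space (dtop T) \<and> second_countable (dtop T) \<and>
     compact_space (dtop T) \<and> collar T B c \<and>
     oriented_pstratifold (Suc n) (dsubspace T (points T - B)) ori \<and> regular (dsubspace T (points T - B)) \<and>
     pstratifold n (dsubspace T B) \<and> regular (dsubspace T B)"

text \<open>The outward direction of the collar at \<open>c(b,s)\<close>, followed by a frame \<open>us\<close> of the boundary.\<close>

definition boundary_frame ::
  "'a dspace \<Rightarrow> 'a set \<Rightarrow> ('a \<times> real \<Rightarrow> 'a) \<Rightarrow> ('m \<Rightarrow> 'a) \<Rightarrow> 'm \<Rightarrow> real \<Rightarrow> 'm tvec list \<Rightarrow> 'a tvec list" where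
  "boundary_frame T B c i x s us = (let T' = dsubspace T (points T - B) in
     (\<lambda>f. if f \<in> smooth T' then - deriv (\<lambda>r. f (c (i x, r))) s else 0) #
     map (pushfwd T' (\<lambda>y. c (i y, s))) us)"

text \<open>Bordism between two cycles: the oriented boundary of \<open>T\<close> is \<open>M \<squnion> -M'\<close>.\<close>

definition bordant :: "nat \<Rightarrow> 'a dspace \<Rightarrow> (real, 'a) cycle_rep \<Rightarrow> (real, 'a) cycle_rep \<Rightarrow> bool" where
  "bordant n X = (\<lambda>(M, ori, g) (M', ori', g').
     \<exists>(T :: real dspace) B c orT H i j. bordism n T B c orT \<and> smooth_map T X H \<and>
       diffeo M (dsubspace T (i ` points M)) i \<and> diffeo M' (dsubspace T (j ` points M')) j \<and>
       i ` points M \<union> j ` points M' = B \<and> i ` points M \<inter> j ` points M' = {} \<and>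
       (\<forall>x \<in> points M. H (i x) = g x) \<and> (\<forall>x \<in> points M'. H (j x) = g' x) \<and>
       (\<forall>x \<in> stratum n M. \<forall>us. tangent_basis M x us \<longrightarrow> (\<forall>s. 0 < s \<and> s < 1 \<longrightarrow>
          (us \<in> ori x \<longleftrightarrow> boundary_frame T B c i x s us \<in> orT (c (i x, s))))) \<and>
       (\<forall>x \<in> stratum n M'. \<forall>us. tangent_basis M' x us \<longrightarrow> (\<forall>s. 0 < s \<and> s < 1 \<longrightarrow>
          (us \<in> ori' x \<longleftrightarrow> boundary_frame T B c j x s us \<notin> orT (c (j x, s))))))"

definition smooth_homologous :: "nat \<Rightarrow> 'a dspace \<Rightarrow> 'a chain \<Rightarrow> 'a chain \<Rightarrow> bool" where
  "smooth_homologous n X z z' \<longleftrightarrow> (\<exists>c \<in> smooth_chains (Suc n) X. z - z' = chain_boundary (Suc n) c)"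

text \<open>The inclusion of smooth into continuous chains induces isomorphisms.\<close>

definition homology_agrees :: "'a dspace \<Rightarrow> bool" where
  "homology_agrees X \<longleftrightarrow> (\<forall>p.
     (\<forall>z. singular_chain p (dtop X) z \<and> chain_boundary p z = 0 \<longrightarrow>
        (\<exists>z' \<in> smooth_cycles p X. \<exists>c. singular_chain (Suc p) (dtop X) c \<and> z - z' = chain_boundary (Suc p) c)) \<and>
     (\<forall>z \<in> smooth_cycles p X. \<forall>c. singular_chain (Suc p) (dtop X) c \<and> z = chain_boundary (Suc p) c \<longrightarrow>
        smooth_homologous p X z 0))"

definition cohomology_agrees :: "'g::ab_group_add itself \<Rightarrow> 'a dspace \<Rightarrow> bool" where
  "cohomology_agrees _ X \<longleftrightarrow>
     (let C = (\<lambda>p. smooth_chains p X); S = (\<lambda>p. singular_chain_set p (dtop X)) in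
      \<forall>p. (\<forall>u :: 'a chain \<Rightarrow> 'g. cocycle C p u \<longrightarrow> (\<exists>u'. cocycle S p u' \<and> coboundary C p (\<lambda>c. u c - u' c))) \<and>
          (\<forall>u :: 'a chain \<Rightarrow> 'g. cocycle S p u \<and> coboundary C p u \<longrightarrow> coboundary S p u))"

definition de_rham :: "'a dspace \<Rightarrow> bool" where
  "de_rham X \<longleftrightarrow> (let C = (\<lambda>p. smooth_chains p X) in \<forall>p.
     (\<forall>u :: 'a chain \<Rightarrow> real. cocycle C p u \<longrightarrow>
        (\<exists>\<omega>. closed_form p X \<omega> \<and> coboundary C p (\<lambda>c. u c - chain_integral p X c \<omega>))) \<and>
     (\<forall>\<omega>. closed_form p X \<omega> \<and> coboundary C p (\<lambda>c. chain_integral p X c \<omega>) \<longrightarrow> exact_form p X \<omega>))"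

text \<open>
  Pushing forward fundamental cycles is well defined and injective (first part) and
  surjective (second part) on bordism classes; it is additive for disjoint unions.
\<close>

definition bordism_is_homology :: "'a dspace \<Rightarrow> bool" where
  "bordism_is_homology X \<longleftrightarrow> (\<forall>n.
     (\<forall>M ori g M' ori' g' c c'. cycle_rep n X (M, ori, g) \<and> cycle_rep n X (M', ori', g') \<and>
        fundamental_cycle n M ori c \<and> fundamental_cycle n M' ori' c' \<longrightarrow>
        (bordant n X (M, ori, g) (M', ori', g') \<longleftrightarrow>
         smooth_homologous n X (chain_map n g c) (chain_map n g' c'))) \<and>
     (\<forall>z \<in> smooth_cycles n X. \<exists>(M :: real dspace) ori g c. cycle_rep n X (M, ori, g) \<and>
        fundamental_cycle n M ori c \<and> smooth_homologous n X z (chain_map n g c)))"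

definition smooth_space :: "'a dspace \<Rightarrow> bool" where
  "smooth_space X \<longleftrightarrow> diff_space X \<and>
     homology_agrees X \<and> cohomology_agrees TYPE(int) X \<and> cohomology_agrees TYPE(real) X \<and>
     de_rham X \<and> bordism_is_homology X"

section \<open>Fiber bundles\<close>

definition fiber :: "'e dspace \<Rightarrow> ('e \<Rightarrow> 'x) \<Rightarrow> 'x \<Rightarrow> 'e dspace" where
  "fiber E \<pi> x = dsubspace E {e \<in> points E. \<pi> e = x}"

text \<open>
  \<open>d\<close> is the dimension of the closed model fiber \<open>F\<close>; \<open>ori\<close> orients all the fibers, its frames
  at \<open>e\<close> being frames of the fiber through \<open>e\<close>. Locally it comes from an orientation of \<open>F\<close>.
\<close>

definition oriented_bundle ::
  "nat \<Rightarrow> 'f dspace \<Rightarrow> 'e dspace \<Rightarrow> 'x dspace \<Rightarrow> ('e \<Rightarrow> 'x) \<Rightarrow> 'e orient \<Rightarrow> bool" where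
  "oriented_bundle d F E X \<pi> ori \<longleftrightarrow> diff_space E \<and> diff_space X \<and> smooth_map E X \<pi> \<and>
     manifold d F \<and> compact_space (dtop F) \<and>
     (\<forall>x \<in> points X. orientation d (fiber E \<pi> x) (\<lambda>e. if \<pi> e = x then ori e else {})) \<and>
     (\<forall>x \<in> points X. \<exists>U \<phi> orF. openin (dtop X) U \<and> x \<in> U \<and> orientation d F orF \<and>
        diffeo (dprod (dsubspace X U) F) (dsubspace E {e \<in> points E. \<pi> e \<in> U}) \<phi> \<and>
        (\<forall>y \<in> U. \<forall>p \<in> points F. \<pi> (\<phi> (y, p)) = y \<and>
           (\<forall>us. tangent_basis F p us \<longrightarrow>
              (us \<in> orF p \<longleftrightarrow> map (pushfwd (fiber E \<pi> y) (\<lambda>q. \<phi> (y, q))) us \<in> ori (\<phi> (y, p))))))"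

text \<open>
  The orientation of \<open>g\<^sup>*E \<subseteq> M \<times> E\<close>: a frame \<open>vs\<close> lifting a frame of \<open>M\<close>, followed by a
  frame \<open>ws\<close> of the fiber, is positive iff both frames are positive or both are negative.
\<close>

definition pullback :: "'m dspace \<Rightarrow> 'e dspace \<Rightarrow> ('e \<Rightarrow> 'x) \<Rightarrow> ('m \<Rightarrow> 'x) \<Rightarrow> ('m \<times> 'e) dspace" where
  "pullback M E \<pi> g = dsubspace (dprod M E) {(m, e). g m = \<pi> e}"

definition pullback_orient :: "nat \<Rightarrow> nat \<Rightarrow> 'm dspace \<Rightarrow> 'm orient \<Rightarrow> 'e dspace \<Rightarrow> ('e \<Rightarrow> 'x) \<Rightarrow>
    'e orient \<Rightarrow> ('m \<Rightarrow> 'x) \<Rightarrow> ('m \<times> 'e) orient" where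
  "pullback_orient n d M orM E \<pi> ori g = (\<lambda>(m, e). let P = pullback M E \<pi> g in
     {us. (m, e) \<in> points P \<and> tangent_basis P (m, e) us \<and>
        (\<exists>vs ws. length vs = n \<and> length ws = d \<and> set vs \<subseteq> tangent P (m, e) \<and>
           tangent_basis M m (map (pushfwd M fst) vs) \<and> tangent_basis (fiber E \<pi> (\<pi> e)) e ws \<and>
           (map (pushfwd M fst) vs \<in> orM m \<longleftrightarrow> ws \<in> ori e) \<and>
           same_orientation us (vs @ map (pushfwd P (\<lambda>e'. (m, e'))) ws))})"

definition PB :: "nat \<Rightarrow> nat \<Rightarrow> 'e dspace \<Rightarrow> ('e \<Rightarrow> 'x) \<Rightarrow> 'e orient \<Rightarrow> 'x geom_cycle \<Rightarrow> 'e geom_cycle" where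
  "PB n d E \<pi> ori \<zeta> = {r'. cycle_rep (n + d) E r' \<and>
     (\<exists>(M, orM, g) \<in> \<zeta>. iso_rep r' (pullback M E \<pi> g, pullback_orient n d M orM E \<pi> ori g, snd))}"

text \<open>
  Fiber integration \<open>\<Omega>\<^sup>k(E) \<rightarrow> \<Omega>\<^sup>k\<^sup>-\<^sup>d(X)\<close>. At the frame \<open>vs\<close> of \<open>X\<close> at \<open>x\<close>, integrate over the
  closed oriented fiber, i.e. over a fundamental cycle, the \<open>d\<close>-form obtained by inserting
  lifts of \<open>vs\<close> into the first \<open>k - d\<close> slots (``base first'': this is the normalization
  in which \<open>\<pi>\<^sup>*\<eta> \<and> \<omega>\<close> is mapped to \<open>\<eta>\<close> wedge the fiber integral of \<open>\<omega>\<close>). The value does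
  not depend on the lifts because the remaining slots are filled with \<open>d\<close> vertical vectors.
\<close>

definition contracted_form ::
  "nat \<Rightarrow> 'e dspace \<Rightarrow> 'x dspace \<Rightarrow> ('e \<Rightarrow> 'x) \<Rightarrow> 'e form \<Rightarrow> 'x tvec list \<Rightarrow> 'e form" where
  "contracted_form k E X \<pi> \<omega> vs = (\<lambda>e ws. let ws' = map (pushfwd E (\<lambda>e'. e')) ws in
     \<omega> e ((SOME us. map (pushfwd X \<pi>) us = vs \<and> us @ ws' \<in> frames k E e) @ ws'))"

definition fiber_int_form ::
  "nat \<Rightarrow> nat \<Rightarrow> 'e dspace \<Rightarrow> 'x dspace \<Rightarrow> ('e \<Rightarrow> 'x) \<Rightarrow> 'e orient \<Rightarrow> 'e form \<Rightarrow> 'x form" where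
  "fiber_int_form k d E X \<pi> ori \<omega> = (\<lambda>x vs. if vs \<in> frames (k - d) X x then
     chain_integral d (fiber E \<pi> x)
       (SOME c. fundamental_cycle d (fiber E \<pi> x) (\<lambda>e. if \<pi> e = x then ori e else {}) c)
       (contracted_form k E X \<pi> \<omega> vs) else 0)"

section \<open>Differential characters and their fiber integration\<close>

definition is_curv :: "nat \<Rightarrow> 'a dspace \<Rightarrow> ('a chain \<Rightarrow> complex) \<Rightarrow> 'a form \<Rightarrow> bool" where
  "is_curv k X h \<omega> \<longleftrightarrow> \<omega> \<in> forms k X \<and>
     (\<forall>c \<in> smooth_chains k X.
        h (chain_boundary k c) = exp (2 * complex_of_real pi * \<i> * complex_of_real (chain_integral k X c \<omega>)))"

definition diff_chars :: "nat \<Rightarrow> 'a dspace \<Rightarrow> ('a chain \<Rightarrow> complex) set" where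
  "diff_chars k X = {h \<in> extensional (smooth_cycles (k - 1) X).
     (\<forall>z \<in> smooth_cycles (k - 1) X. cmod (h z) = 1) \<and>
     (\<forall>z \<in> smooth_cycles (k - 1) X. \<forall>z' \<in> smooth_cycles (k - 1) X. h (z + z') = h z * h z') \<and>
     (\<exists>\<omega>. is_curv k X h \<omega>)}"

definition curv :: "nat \<Rightarrow> 'a dspace \<Rightarrow> ('a chain \<Rightarrow> complex) \<Rightarrow> 'a form" where
  "curv k X h = (THE \<omega>. is_curv k X h \<omega>)"

text \<open>Evaluation on a class on which \<open>h\<close> is constant.\<close>

definition eval_class :: "('a chain \<Rightarrow> complex) \<Rightarrow> 'a chain set \<Rightarrow> complex" where
  "eval_class h A = the_elem (h ` A)"

definition geom_choice ::
  "nat \<Rightarrow> 'x dspace \<Rightarrow> ('x chain \<Rightarrow> 'x geom_cycle) \<Rightarrow> ('x chain \<Rightarrow> 'x chain) \<Rightarrow> bool" where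
  "geom_choice n X \<zeta> a \<longleftrightarrow> (\<forall>z \<in> smooth_cycles n X.
     \<zeta> z \<in> geom_cycles n X \<and> a z \<in> smooth_chains (Suc n) X \<and>
     thin_class n X (z - chain_boundary (Suc n) (a z)) = geom_class n X (\<zeta> z))"

definition transfer_map ::
  "nat \<Rightarrow> nat \<Rightarrow> 'e dspace \<Rightarrow> 'x dspace \<Rightarrow> ('e \<Rightarrow> 'x) \<Rightarrow> 'e orient \<Rightarrow>
   ('x chain \<Rightarrow> 'x geom_cycle) \<Rightarrow> ('x chain \<Rightarrow> 'e chain) \<Rightarrow> bool" where
  "transfer_map n d E X \<pi> ori \<zeta> tr \<longleftrightarrow> (\<forall>z \<in> smooth_cycles n X.
     tr z \<in> smooth_cycles (n + d) E \<and>
     thin_class (n + d) E (tr z) = geom_class (n + d) E (PB n d E \<pi> ori (\<zeta> z)))"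

definition fiber_int_char ::
  "nat \<Rightarrow> nat \<Rightarrow> 'e dspace \<Rightarrow> 'x dspace \<Rightarrow> ('e \<Rightarrow> 'x) \<Rightarrow> 'e orient \<Rightarrow>
   ('x chain \<Rightarrow> 'x geom_cycle) \<Rightarrow> ('x chain \<Rightarrow> 'x chain) \<Rightarrow> ('e chain \<Rightarrow> complex) \<Rightarrow> 'x chain \<Rightarrow> complex" where
  "fiber_int_char k d E X \<pi> ori \<zeta> a h =
     (\<lambda>z \<in> smooth_cycles (k - 1 - d) X.
        eval_class h (geom_class (k - 1) E (PB (k - 1 - d) d E \<pi> ori (\<zeta> z))) *
        exp (2 * complex_of_real pi * \<i> *
          complex_of_real (chain_integral (k - d) X (a z) (fiber_int_form k d E X \<pi> ori (curv k E h)))))"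

end

theory Submission
  imports Defs
begin

text \<open>
  The formula only requires that \<open>h\<close> be constant on the class of \<open>\<lambda>(z)\<close> modulo boundaries of
  thin chains: on the boundary of a thin chain \<open>y\<close>, \<open>h\<close> is the exponential of the integral of
  its curvature over \<open>y\<close>, that is 1. Additivity of \<open>h\<close> applies because boundaries of smooth
  chains are smooth, the face inclusions of the standard simplices being restrictions of smooth
  maps of Euclidean spaces.
\<close>

lemma smooth_map_compose:
  "smooth_map X Y f \<Longrightarrow> smooth_map Y Z g \<Longrightarrow> smooth_map X Z (g \<circ> f)"
  by (auto simp: smooth_map_def simp flip: comp_assoc)

lemma topspace_init_top [simp]: "topspace (init_top A G) = A"
  by (auto simp: init_top_def)

text \<open>Continuity may be tested on generating sets: \<open>\<phi>\<close> pulls the set given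
  by \<open>f\<close> and \<open>U\<close> back to the set given by \<open>f \<circ> \<phi>\<close>
  and \<open>U\<close>, which is a generating set of the source.\<close>

lemma continuous_map_init_top:
  assumes "\<phi> \<in> A \<rightarrow> B" "\<And>g. g \<in> H \<Longrightarrow> g \<circ> \<phi> \<in> G"
  shows "continuous_map (init_top A G) (init_top B H) \<phi>"
  unfolding init_top_def [of B H]
proof (rule continuous_on_generated_topo)
  fix V assume V: "V \<in> insert B {{x \<in> B. f x \<in> U} |f U. f \<in> H \<and> open U}"
  then consider "V = B" | f U where "f \<in> H" "open U" "V = {x \<in> B. f x \<in> U}"
    by blast
  then show "openin (init_top A G) (\<phi> -` V \<inter> topspace (init_top A G))"
  proof cases
    case 1
    then have "\<phi> -` V \<inter> topspace (init_top A G) = topspace (init_top A G)"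
      using assms(1) by auto
    then show ?thesis
      by (metis openin_topspace)
  next
    case 2
    then have "\<phi> -` V \<inter> topspace (init_top A G) = {x \<in> A. (f \<circ> \<phi>) x \<in> U}"
      using assms(1) by auto
    moreover have "openin (init_top A G) {x \<in> A. (f \<circ> \<phi>) x \<in> U}"
      using assms(2) [OF 2(1)] 2(2)
      unfolding init_top_def by (intro topology_generated_by_Basis) blast
    ultimately show ?thesis
      by simp
  qed
next
  show "\<phi> ` topspace (init_top A G) \<subseteq> \<Union> (insert B {{x \<in> B. f x \<in> U} |f U. f \<in> H \<and> open U})"
    using assms(1) by auto
qed

text \<open>Smoothness only has to be tested on generators: a local expression of \<open>g\<close>
  through \<open>F\<close> and \<open>fs\<close> becomes one of \<open>g \<circ> \<phi>\<close>
  through \<open>F\<close> and the \<open>fs i \<circ> \<phi>\<close>, valid on the preimage of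
  \<open>U\<close>, which is open by continuity.\<close>

lemma smooth_map_generated:
  assumes "\<phi> \<in> A \<rightarrow> B" "\<And>g. g \<in> H \<Longrightarrow> g \<circ> \<phi> \<in> G"
  shows "smooth_map (generated A G) (generated B H) \<phi>"
  unfolding smooth_map_def
proof (intro conjI ballI)
  show "\<phi> \<in> points (generated A G) \<rightarrow> points (generated B H)"
    using assms(1) by (simp add: generated_def)
next
  fix g assume g: "g \<in> smooth (generated B H)"
  have "\<exists>U n F fs. openin (init_top A G) U \<and> x \<in> U \<and> F \<in> smooth_Rn n \<and> (\<forall>i<n. fs i \<in> G) \<and>
      (\<forall>y\<in>U. (g \<circ> \<phi>) y = comp_fun n F fs y)" if "x \<in> A" for x
  proof -
    have "\<phi> x \<in> B"
      using assms(1) that by auto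
    with g obtain U n F fs where U: "openin (init_top B H) U" "\<phi> x \<in> U" "F \<in> smooth_Rn n"
      "\<forall>i<n. fs i \<in> H" "\<forall>y\<in>U. g y = comp_fun n F fs y"
      by (auto simp: generated_def)
    have "openin (init_top A G) {y \<in> A. \<phi> y \<in> U}"
      using openin_continuous_map_preimage [OF continuous_map_init_top [OF assms] U(1)] by simp
    moreover have "comp_fun n F fs (\<phi> y) = comp_fun n F (\<lambda>i. fs i \<circ> \<phi>) y" for y
      by (simp only: comp_fun_def o_apply)
    ultimately show ?thesis
      using U that assms(2)
      by (intro exI [of _ "{y \<in> A. \<phi> y \<in> U}"] exI [of _ n] exI [of _ F]
          exI [of _ "\<lambda>i. fs i \<circ> \<phi>"]) auto
  qed
  then show "g \<circ> \<phi> \<in> smooth (generated A G)"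
    by (simp add: generated_def)
qed

text \<open>Local expressions are compared with the function on open sets only, and these lie inside
  the carrier.\<close>

lemma smooth_generated_cong:
  assumes "f \<in> smooth (generated A G)" "\<And>x. x \<in> A \<Longrightarrow> f' x = f x"
  shows "f' \<in> smooth (generated A G)"
proof -
  have "U \<subseteq> A" if "openin (init_top A G) U" for U
    using openin_subset [OF that] by simp
  then have "openin (init_top A G) U \<and> x \<in> U \<and> F \<in> smooth_Rn n \<and> (\<forall>i<n. fs i \<in> G) \<and>
        (\<forall>y\<in>U. f y = comp_fun n F fs y) \<longleftrightarrow>
      openin (init_top A G) U \<and> x \<in> U \<and> F \<in> smooth_Rn n \<and> (\<forall>i<n. fs i \<in> G) \<and>
        (\<forall>y\<in>U. f' y = comp_fun n F fs y)" for U x n F fs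
    using assms(2) by (metis subsetD)
  with assms(1) show ?thesis
    unfolding generated_def dspace.simps mem_Collect_eq by (simp only:)
qed

text \<open>Meant for faces of simplices: \<open>singular_face\<close> is the composite with
  \<open>simplical_face\<close> restricted to the standard simplex, so agreement is guaranteed only
  there.\<close>

lemma smooth_map_generated_cong:
  assumes "smooth_map (generated A G) Y f" "\<And>x. x \<in> A \<Longrightarrow> f' x = f x"
  shows "smooth_map (generated A G) Y f'"
  unfolding smooth_map_def
proof (intro conjI ballI)
  show "f' \<in> points (generated A G) \<rightarrow> points Y"
    using assms by (auto simp: smooth_map_def generated_def)
next
  fix g assume "g \<in> smooth Y"
  then have "g \<circ> f \<in> smooth (generated A G)"
    using assms(1) by (simp add: smooth_map_def)
  then show "g \<circ> f' \<in> smooth (generated A G)"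
    by (rule smooth_generated_cong) (simp add: assms(2))
qed

lemma simplical_face_in_Euclidean_space:
  assumes "k \<le> n" "x \<in> topspace (Euclidean_space n)"
  shows "simplical_face k x \<in> topspace (Euclidean_space (Suc n))"
  using assms by (auto simp: topspace_Euclidean_space simplical_face_def)

lemma continuous_map_simplical_face:
  assumes "k \<le> n"
  shows "continuous_map (Euclidean_space n) (Euclidean_space (Suc n)) (simplical_face k)"
proof -
  have "continuous_map (Euclidean_space n) euclideanreal (\<lambda>x. simplical_face k x i)" for i
    by (auto simp: simplical_face_def Euclidean_space_def
        intro!: continuous_map_from_subtopology continuous_map_product_projection)
  then show ?thesis
    using simplical_face_in_Euclidean_space [OF assms]
    by (auto simp: Euclidean_space_def [of "Suc n"] continuous_map_in_subtopology
        continuous_map_componentwise_UNIV topspace_Euclidean_space)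
qed

text \<open>The face map inserts a zero at position \<open>k\<close>. Varying one coordinate of
  \<open>x\<close> therefore varies exactly one coordinate of its image, at unit speed, and each
  partial derivative of the composite is a partial derivative of \<open>f\<close>.\<close>

lemma smooth_Rn_simplical_face:
  assumes k: "k \<le> n" and f: "f \<in> smooth_Rn (Suc n)"
  shows "f \<circ> simplical_face k \<in> smooth_Rn n"
proof -
  \<comment> \<open>\<open>s\<close> gives the new position of coordinate \<open>j\<close> once the
    zero has been inserted.\<close>
  define s where "s \<equiv> \<lambda>j. if j < k then j else Suc j"
  obtain D where D0: "\<And>x. x \<in> topspace (Euclidean_space (Suc n)) \<Longrightarrow> D [] x = f x"
    and Dcont: "\<And>is. set is \<subseteq> {..<Suc n} \<Longrightarrow> continuous_map (Euclidean_space (Suc n)) euclideanreal (D is)"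
    and Dder: "\<And>is i x. set is \<subseteq> {..<Suc n} \<Longrightarrow> i < Suc n \<Longrightarrow> x \<in> topspace (Euclidean_space (Suc n)) \<Longrightarrow>
        ((\<lambda>t. D is (x(i := t))) has_real_derivative D (i # is) x) (at (x i))"
    using f unfolding smooth_Rn_def by blast
  have face_upd: "simplical_face k (x(j := t)) = (simplical_face k x)(s j := t)" for x j and t :: real
    by (auto simp: simplical_face_def s_def fun_eq_iff)
  have face_s: "simplical_face k x (s j) = x j" for x :: "nat \<Rightarrow> real" and j
    by (simp add: simplical_face_def s_def)
  have s: "set (map s is) \<subseteq> {..<Suc n}" if "set is \<subseteq> {..<n}" for "is"
    using that by (auto simp: s_def)
  show ?thesis
    unfolding smooth_Rn_def mem_Collect_eq
  \<comment> \<open>The derivative of the composite along a multi-index is that of \<open>f\<close>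
    along the renumbered multi-index, pulled back.\<close>
  proof (intro exI [of _ "\<lambda>is. D (map s is) \<circ> simplical_face k"] conjI allI impI ballI)
    fix x assume "x \<in> topspace (Euclidean_space n)"
    then show "(D (map s []) \<circ> simplical_face k) x = (f \<circ> simplical_face k) x"
      using D0 simplical_face_in_Euclidean_space [OF k] by simp
  next
    fix "is" :: "nat list" assume "set is \<subseteq> {..<n}"
    then show "continuous_map (Euclidean_space n) euclideanreal (D (map s is) \<circ> simplical_face k)"
      using continuous_map_compose continuous_map_simplical_face [OF k] Dcont s by blast
  next
    fix "is" :: "nat list" and i x
    assume "set is \<subseteq> {..<n}" "i < n" "x \<in> topspace (Euclidean_space n)"
    moreover from \<open>i < n\<close> have "s i < Suc n"
      by (simp add: s_def)
    ultimately show "((\<lambda>t. (D (map s is) \<circ> simplical_face k) (x(i := t))) has_real_derivative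
        (D (map s (i # is)) \<circ> simplical_face k) x) (at (x i))"
      using Dder [OF s, of "is" "s i" "simplical_face k x"] simplical_face_in_Euclidean_space [OF k]
      by (simp add: face_upd face_s)
  qed
qed

lemma standard_simplex_subset_Euclidean_space:
  "standard_simplex p \<subseteq> topspace (Euclidean_space (Suc p))"
  by (auto simp: standard_simplex_def topspace_Euclidean_space)

text \<open>Brings the domain of a smooth simplex into the form to which
  \<open>smooth_map_generated\<close> applies.\<close>

lemma dsubspace_Rn_standard_simplex:
  "dsubspace (Rn (Suc p)) (standard_simplex p) = generated (standard_simplex p) (smooth_Rn (Suc p))"
  using standard_simplex_subset_Euclidean_space [of p]
  by (simp add: dsubspace_def Rn_def Int_absorb2)

lemma smooth_simplex_singular_face:
  assumes "smooth_simplex (Suc p) X \<sigma>" "k \<le> Suc p"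
  shows "smooth_simplex p X (singular_face (Suc p) k \<sigma>)"
proof -
  have "simplical_face k \<in> standard_simplex p \<rightarrow> standard_simplex (Suc p)"
    using simplical_face_in_standard_simplex [of "Suc p" k] assms(2) by auto
  then have "smooth_map (generated (standard_simplex p) (smooth_Rn (Suc p)))
      (generated (standard_simplex (Suc p)) (smooth_Rn (Suc (Suc p)))) (simplical_face k)"
    using smooth_Rn_simplical_face [OF assms(2)] by (rule smooth_map_generated)
  then have "smooth_map (generated (standard_simplex p) (smooth_Rn (Suc p))) X (\<sigma> \<circ> simplical_face k)"
    using assms(1) smooth_map_compose
    unfolding smooth_simplex_def dsubspace_Rn_standard_simplex by blast
  then have "smooth_map (generated (standard_simplex p) (smooth_Rn (Suc p))) X (singular_face (Suc p) k \<sigma>)"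
    by (rule smooth_map_generated_cong) (simp add: singular_face_def)
  moreover have "singular_simplex p (dtop X) (singular_face (Suc p) k \<sigma>)"
    using singular_simplex_singular_face [of "Suc p" "dtop X" \<sigma> k] assms
    by (simp add: smooth_simplex_def)
  ultimately show ?thesis
    by (simp add: smooth_simplex_def dsubspace_Rn_standard_simplex)
qed

text \<open>Every simplex occurring in the boundary is a face of a simplex of \<open>c\<close>;
  signs and cancellation can only remove simplices.\<close>

lemma smooth_chains_boundary:
  assumes "c \<in> smooth_chains (Suc p) X"
  shows "chain_boundary (Suc p) c \<in> smooth_chains p X"
proof -
  have "Poly_Mapping.keys (\<Sum>k\<le>Suc p. frag_cmul ((-1) ^ k) (frag_of (singular_face (Suc p) k \<sigma>)))
      \<subseteq> Collect (smooth_simplex p X)" if "\<sigma> \<in> Poly_Mapping.keys c" for \<sigma>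
  proof -
    have "Poly_Mapping.keys (\<Sum>k\<le>Suc p. frag_cmul ((-1) ^ k) (frag_of (singular_face (Suc p) k \<sigma>)))
      \<subseteq> (\<Union>k\<le>Suc p. Poly_Mapping.keys (frag_cmul ((-1) ^ k) (frag_of (singular_face (Suc p) k \<sigma>))))"
      by (rule keys_sum)
    also have "\<dots> \<subseteq> (\<Union>k\<le>Suc p. {singular_face (Suc p) k \<sigma>})"
      by (intro UN_mono order_refl order_trans [OF keys_cmul]) simp
    also have "\<dots> \<subseteq> Collect (smooth_simplex p X)"
      using assms that smooth_simplex_singular_face [of p X \<sigma>] by (auto simp: smooth_chains_def)
    finally show ?thesis .
  qed
  then have "Poly_Mapping.keys (chain_boundary (Suc p) c) \<subseteq> Collect (smooth_simplex p X)"
    unfolding chain_boundary_def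
    \<comment> \<open>The degree is a successor, so the default value 0 of
      \<open>chain_boundary\<close> in degree 0 does not arise.\<close>
    by (simp only: nat.distinct if_False) (rule order_trans [OF keys_frag_extend UN_least])
  then show ?thesis
    by (simp add: smooth_chains_def)
qed

lemma smooth_chains_imp_singular_chain:
  "c \<in> smooth_chains p X \<Longrightarrow> singular_chain p (dtop X) c"
  by (auto simp: smooth_chains_def singular_chain_def smooth_simplex_def)

lemma smooth_cycles_boundary:
  assumes "c \<in> smooth_chains (Suc p) X"
  shows "chain_boundary (Suc p) c \<in> smooth_cycles p X"
  using assms smooth_chains_boundary
    chain_boundary_boundary_alt [OF smooth_chains_imp_singular_chain [OF assms]]
  by (simp add: smooth_cycles_def)

lemma diff_char_thin_class:
  assumes h: "h \<in> diff_chars (Suc n) X" and z: "z \<in> smooth_cycles n X" and "c \<in> thin_class n X z"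
  shows "h c = h z"
proof -
  obtain y where y: "y \<in> thin_chains (Suc n) X" and c: "c = z + chain_boundary (Suc n) y"
    using assms(3) by (auto simp: thin_class_def)
  obtain \<omega> where "is_curv (Suc n) X h \<omega>"
    using h by (auto simp: diff_chars_def)
  \<comment> \<open>The integral of \<open>\<omega>\<close> over the thin chain \<open>y\<close>
    vanishes, and the exponential of 0 is 1.\<close>
  with y have "h (chain_boundary (Suc n) y) = 1"
    by (simp add: is_curv_def thin_chains_def)
  \<comment> \<open>Multiplicativity of \<open>h\<close> is available on cycles only.\<close>
  moreover have "chain_boundary (Suc n) y \<in> smooth_cycles n X"
    using y smooth_cycles_boundary by (auto simp: thin_chains_def)
  ultimately show ?thesis
    using h z by (simp add: c diff_chars_def)
qed

text \<open>The zero chain is thin. Hence the class is nonempty, and the image of the class under a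
  character is exactly a singleton, as \<open>the_elem\<close> in \<open>eval_class\<close>
  requires.\<close>

lemma thin_class_self: "z \<in> thin_class n X z"
proof -
  have "0 \<in> thin_chains (Suc n) X"
    by (simp add: thin_chains_def smooth_chains_def chain_integral_def)
  then show ?thesis
    unfolding thin_class_def by force
qed

lemma eval_class_thin_class:
  assumes "h \<in> diff_chars (Suc n) X" "z \<in> smooth_cycles n X"
  shows "eval_class h (thin_class n X z) = h z"
proof -
  have "h ` thin_class n X z = {h z}"
    using diff_char_thin_class [OF assms] thin_class_self by blast
  then show ?thesis
    by (simp add: eval_class_def)
qed

theorem lemma7p4:
  fixes X :: "'x dspace" and E :: "'e dspace" and F :: "'f dspace"
    and \<pi> :: "'e \<Rightarrow> 'x" and ori :: "'e orient" and k d :: nat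
    and \<zeta> :: "'x chain \<Rightarrow> 'x geom_cycle" and a :: "'x chain \<Rightarrow> 'x chain"
    and h :: "'e chain \<Rightarrow> complex" and tr :: "'x chain \<Rightarrow> 'e chain" and z :: "'x chain"
  assumes "smooth_space X"
    and "oriented_bundle d F E X \<pi> ori"
    and "k > d"
    and "h \<in> diff_chars k E"
    and "geom_choice (k - 1 - d) X \<zeta> a"
    and "transfer_map (k - 1 - d) d E X \<pi> ori \<zeta> tr"
    and "z \<in> smooth_cycles (k - 1 - d) X"
  shows "fiber_int_char k d E X \<pi> ori \<zeta> a h z =
    h (tr z) * exp (2 * complex_of_real pi * \<i> *
      complex_of_real (chain_integral (k - d) X (a z) (fiber_int_form k d E X \<pi> ori (curv k E h))))"
proof -
  define n where "n = k - 1 - d"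
  \<comment> \<open>As \<open>k > d\<close>, the truncated subtractions are genuine:
    \<open>k - 1\<close> is \<open>n + d\<close>, the degree of the transferred cycle, and
    \<open>k - d\<close> is \<open>Suc n\<close>, the degree of \<open>a z\<close>.\<close>
  have k: "k = Suc (n + d)"
    using assms(3) by (simp add: n_def)
  have "tr z \<in> smooth_cycles (n + d) E"
    "thin_class (n + d) E (tr z) = geom_class (n + d) E (PB n d E \<pi> ori (\<zeta> z))"
    using assms(6,7) by (auto simp: transfer_map_def n_def)
  \<comment> \<open>The transfer property replaces the class of the pulled-back geometric cycle by
    the thin class of \<open>tr z\<close>; the exponential factor is the same on both sides of the
    claim.\<close>
  then have "eval_class h (geom_class (n + d) E (PB n d E \<pi> ori (\<zeta> z))) = h (tr z)"
    using eval_class_thin_class assms(4) k by metis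
  then show ?thesis
    using assms(7) by (simp add: fiber_int_char_def k)
qed

end
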